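(* Let $G$ be a topological group acting continuously on a coarsely connected coarse space $(X,\mathcal{E}_X)$ (carrying a topology), by uniform coarse equivalences. Suppose that either (a) $G$ is a Polish group, or (b) $X$ is a pseudometric space $(X,d_X)$ with the coarse structure and topology induced by $d_X$. Then the following conditions are equivalent: (1) The action $G\curvearrowright X$ is coarsely proper. (2) For every $x\in X$, the orbit map $\rho_x\colon G\to X$, $\rho_x(g)=gx$, is coarsely proper. (3) For every coarsely bounded subset $B\subseteq X$ and every entourage $E\in\mathcal{E}_X$, the transporter $(E[B]\mid E[B])_G$ is coarsely bounded in $G$. Furthermore, if $G$ is locally bounded, these conditions are equivalent to: (4) There are no coarsely bounded subsets $A,B\subseteq X$ that are coarsely dynamically related.
   Context: A coarse structure on a set $X$ is a collection $\mathcal{E}$ of subsets of $X\times X$ (entourages) that contains the diagonal $\Delta_X$ and is closed under subsets, finite unions, compositions $E\circ F=\{(x,z)\mid \exists y,\ (x,y)\in E,\ (y,z)\in F\}$ and inverses. $(X,\mathcal{E})$ is a coarse space; it is coarsely connected if $\{(x,y)\}\in\mathcal{E}$ for all $x,y\in X$. A subset $B\subseteq X$ is coarsely bounded if $B\times B\in\mathcal{E}$. For $E\subseteq X\times X$ and $A\subseteq X$, $E[A]=\{x\in X\mid \exists a\in A,\ (x,a)\in E\}$. A pseudometric $d$ is a symmetric, non-negative real-valued function satisfying the triangle inequality and $d(x,x)=0$. A pseudometric space $(X,d_X)$ carries the topology induced by $d_X$ and the coarse structure of all subsets of the sets $E_r=\{(x,y)\mid d_X(x,y)\le r\}$, $r\ge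 0$. A topological group $G$ carries its left-coarse structure $\mathcal{E}_{\mathcal{P}}=\{E\subseteq G\times G\mid \forall d\in\mathcal{P},\ \sup_{(x,y)\in E}d(x,y)<\infty\}$, where $\mathcal{P}$ is the family of all continuous left-invariant pseudometrics on $G$; thus $B\subseteq G$ is coarsely bounded iff it has finite diameter for every $d\in\mathcal{P}$. $G$ is locally bounded if it has a coarsely bounded neighbourhood of the identity. An action of $G$ on $X$ is continuous if $G\times X\to X$, $(g,x)\mapsto gx$, is continuous. It is by uniform coarse equivalences if for every $E\in\mathcal{E}_X$ there is $M_E\in\mathcal{E}_X$ with $\bigcup_{g\in G}gE\subseteq M_E$, where $gE=\{(gx,gy)\mid (x,y)\in E\}$. The transporter is $(A\mid B)_G=\{g\in G\mid gA\cap B\ne\emptyset\}$. The action is coarsely proper if $(B\mid B)_G$ is coarsely bounded in $G$ for every coarsely bounded $B\subseteq X$. A map $\phi\colon X\to Y$ of coarse spaces is coarsely proper if preimages of coarsely bounded sets are coarsely bounded. For a sequence $(g_n)$ in $G$, $g_n\to_{\tau_{OB}}\infty$ means that the sequence eventually leaves every coarsely bounded subset of $G$. Coarsely bounded sets $A,B\subseteq X$ are coarsely dynamically related if there is a sequence $g_n\in G$ with $g_n\to_{\tau_{OB}}\infty$ and $g_nA\cap B\neq\emptyset$ for all $n$. *)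

theory Defs
  imports "HOL-Analysis.Analysis" "HOL-Algebra.Group_Action"
begin

section \<open>Coarse spaces\<close>

locale coarse_space =
  fixes X :: "'x set" and \<E> :: "('x \<times> 'x) set set"
  assumes entourages_subset: "\<E> \<subseteq> Pow (X \<times> X)"
    and diagonal: "Id_on X \<in> \<E>"
    and subset_closed: "\<lbrakk>E \<in> \<E>; F \<subseteq> E\<rbrakk> \<Longrightarrow> F \<in> \<E>"
    and Un_closed: "\<lbrakk>E \<in> \<E>; F \<in> \<E>\<rbrakk> \<Longrightarrow> E \<union> F \<in> \<E>"
    and comp_closed: "\<lbrakk>E \<in> \<E>; F \<in> \<E>\<rbrakk> \<Longrightarrow> E O F \<in> \<E>"
    and inverse_closed: "E \<in> \<E> \<Longrightarrow> E\<inverse> \<in> \<E>"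

definition coarsely_connected :: "'x set \<Rightarrow> ('x \<times> 'x) set set \<Rightarrow> bool"
  where "coarsely_connected X \<E> \<longleftrightarrow> (\<forall>x\<in>X. \<forall>y\<in>X. {(x, y)} \<in> \<E>)"

definition coarsely_bounded :: "'x set \<Rightarrow> ('x \<times> 'x) set set \<Rightarrow> 'x set \<Rightarrow> bool"
  where "coarsely_bounded X \<E> B \<longleftrightarrow> B \<subseteq> X \<and> B \<times> B \<in> \<E>"

text \<open>The thickening \<open>E[A]\<close>. The point of \<open>A\<close> is the second coordinate, so this is
  \<open>E\<inverse> `` A\<close> rather than the relational image \<open>E `` A\<close>.\<close>

definition thickening :: "'x set \<Rightarrow> ('x \<times> 'x) set \<Rightarrow> 'x set \<Rightarrow> 'x set"
  where "thickening X E A = {x \<in> X. \<exists>a\<in>A. (x, a) \<in> E}"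

definition coarsely_proper_map ::
    "'x set \<Rightarrow> ('x \<times> 'x) set set \<Rightarrow> 'y set \<Rightarrow> ('y \<times> 'y) set set \<Rightarrow> ('x \<Rightarrow> 'y) \<Rightarrow> bool"
  where "coarsely_proper_map X \<E> Y \<F> f \<longleftrightarrow>
    f \<in> X \<rightarrow> Y \<and> (\<forall>B. coarsely_bounded Y \<F> B \<longrightarrow> coarsely_bounded X \<E> {x \<in> X. f x \<in> B})"


section \<open>Pseudometrics\<close>

locale pseudometric_space =
  fixes X :: "'x set" and d :: "'x \<Rightarrow> 'x \<Rightarrow> real"
  assumes nonneg: "\<lbrakk>x \<in> X; y \<in> X\<rbrakk> \<Longrightarrow> 0 \<le> d x y"
    and zero: "x \<in> X \<Longrightarrow> d x x = 0"
    and commute: "\<lbrakk>x \<in> X; y \<in> X\<rbrakk> \<Longrightarrow> d x y = d y x"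
    and triangle: "\<lbrakk>x \<in> X; y \<in> X; z \<in> X\<rbrakk> \<Longrightarrow> d x z \<le> d x y + d y z"

definition pseudometric_topology :: "'x set \<Rightarrow> ('x \<Rightarrow> 'x \<Rightarrow> real) \<Rightarrow> 'x topology"
  where "pseudometric_topology X d =
    topology (\<lambda>U. U \<subseteq> X \<and> (\<forall>x\<in>U. \<exists>r>0. {y \<in> X. d x y < r} \<subseteq> U))"

lemma openin_pseudometric_topology:
  "openin (pseudometric_topology X d) U \<longleftrightarrow>
    U \<subseteq> X \<and> (\<forall>x\<in>U. \<exists>r>0. {y \<in> X. d x y < r} \<subseteq> U)"
proof -
  let ?P = "\<lambda>U. U \<subseteq> X \<and> (\<forall>x\<in>U. \<exists>r>0. {y \<in> X. d x y < r} \<subseteq> U)"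
  have "?P (S \<inter> T)" if S: "?P S" and T: "?P T" for S T
  proof (intro conjI ballI)
    fix x assume x: "x \<in> S \<inter> T"
    obtain r where r: "r > 0" "{y \<in> X. d x y < r} \<subseteq> S" using S x by blast
    obtain s where s: "s > 0" "{y \<in> X. d x y < s} \<subseteq> T" using T x by blast
    have "min r s > 0" "{y \<in> X. d x y < min r s} \<subseteq> S \<inter> T" using r s by auto
    then show "\<exists>r>0. {y \<in> X. d x y < r} \<subseteq> S \<inter> T" by blast
  qed (use S in blast)
  moreover have "?P (\<Union>\<K>)" if \<K>: "\<forall>K\<in>\<K>. ?P K" for \<K>
  proof (intro conjI ballI)
    fix x assume "x \<in> \<Union>\<K>"
    then obtain K where "K \<in> \<K>" "x \<in> K" by blast
    then obtain r where "r > 0" "{y \<in> X. d x y < r} \<subseteq> K" using \<K> by blast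
    then show "\<exists>r>0. {y \<in> X. d x y < r} \<subseteq> \<Union>\<K>" using \<open>K \<in> \<K>\<close> by blast
  qed (use \<K> in blast)
  ultimately have "istopology ?P" unfolding istopology_def by blast
  then show ?thesis unfolding pseudometric_topology_def by (simp add: topology_inverse')
qed

definition pseudometric_coarse_structure ::
    "'x set \<Rightarrow> ('x \<Rightarrow> 'x \<Rightarrow> real) \<Rightarrow> ('x \<times> 'x) set set"
  where "pseudometric_coarse_structure X d =
    {E. \<exists>r\<ge>0. E \<subseteq> {(x, y) \<in> X \<times> X. d x y \<le> r}}"


section \<open>Topological groups and their left-coarse structure\<close>

text \<open>No separation axiom is part of the definition.\<close>

locale topological_group = group G for G (structure) +
  fixes T :: "'a topology"
  assumes topspace_eq_carrier: "topspace T = carrier G"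
    and continuous_mult: "continuous_map (prod_topology T T) T (\<lambda>(x, y). x \<otimes> y)"
    and continuous_inv: "continuous_map T T (\<lambda>x. inv x)"

definition polish_topology :: "'a topology \<Rightarrow> bool"
  where "polish_topology T \<longleftrightarrow> completely_metrizable_space T \<and> separable_space T"

definition left_invariant_pseudometrics ::
    "('a, 'm) monoid_scheme \<Rightarrow> 'a topology \<Rightarrow> ('a \<Rightarrow> 'a \<Rightarrow> real) set"
  where "left_invariant_pseudometrics G T =
    {d. pseudometric_space (carrier G) d \<and>
        continuous_map (prod_topology T T) euclideanreal (\<lambda>(x, y). d x y) \<and>
        (\<forall>g\<in>carrier G. \<forall>x\<in>carrier G. \<forall>y\<in>carrier G. d (g \<otimes>\<^bsub>G\<^esub> x) (g \<otimes>\<^bsub>G\<^esub> y) = d x y)}"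

definition left_coarse_structure ::
    "('a, 'm) monoid_scheme \<Rightarrow> 'a topology \<Rightarrow> ('a \<times> 'a) set set"
  where "left_coarse_structure G T =
    {E. E \<subseteq> carrier G \<times> carrier G \<and>
        (\<forall>d\<in>left_invariant_pseudometrics G T. bdd_above ((\<lambda>(x, y). d x y) ` E))}"

abbreviation group_coarsely_bounded ::
    "('a, 'm) monoid_scheme \<Rightarrow> 'a topology \<Rightarrow> 'a set \<Rightarrow> bool"
  where "group_coarsely_bounded G T \<equiv> coarsely_bounded (carrier G) (left_coarse_structure G T)"

definition locally_bounded_group :: "('a, 'm) monoid_scheme \<Rightarrow> 'a topology \<Rightarrow> bool"
  where "locally_bounded_group G T \<longleftrightarrow>
    (\<exists>U N. openin T U \<and> \<one>\<^bsub>G\<^esub> \<in> U \<and> U \<subseteq> N \<and> group_coarsely_bounded G T N)"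

definition tends_to_coarse_infinity ::
    "('a, 'm) monoid_scheme \<Rightarrow> 'a topology \<Rightarrow> (nat \<Rightarrow> 'a) \<Rightarrow> bool"
  where "tends_to_coarse_infinity G T g \<longleftrightarrow>
    (\<forall>B. group_coarsely_bounded G T B \<longrightarrow> (\<forall>\<^sub>F n in sequentially. g n \<notin> B))"


section \<open>Actions\<close>

text \<open>The action is given by \<open>\<phi> :: 'a \<Rightarrow> 'x \<Rightarrow> 'x\<close>, as in \<^locale>\<open>group_action\<close>:
  \<open>g x\<close> is \<open>\<phi> g x\<close>.\<close>

definition continuous_action :: "'a topology \<Rightarrow> 'x topology \<Rightarrow> ('a \<Rightarrow> 'x \<Rightarrow> 'x) \<Rightarrow> bool"
  where "continuous_action T S \<phi> \<longleftrightarrow> continuous_map (prod_topology T S) S (\<lambda>(g, x). \<phi> g x)"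

definition by_uniform_coarse_equivalences ::
    "('a, 'm) monoid_scheme \<Rightarrow> ('x \<times> 'x) set set \<Rightarrow> ('a \<Rightarrow> 'x \<Rightarrow> 'x) \<Rightarrow> bool"
  where "by_uniform_coarse_equivalences G \<E> \<phi> \<longleftrightarrow>
    (\<forall>E\<in>\<E>. \<exists>M\<in>\<E>. (\<Union>g\<in>carrier G. (\<lambda>(x, y). (\<phi> g x, \<phi> g y)) ` E) \<subseteq> M)"

definition transporter ::
    "('a, 'm) monoid_scheme \<Rightarrow> ('a \<Rightarrow> 'x \<Rightarrow> 'x) \<Rightarrow> 'x set \<Rightarrow> 'x set \<Rightarrow> 'a set"
  where "transporter G \<phi> A B = {g \<in> carrier G. \<phi> g ` A \<inter> B \<noteq> {}}"

definition coarsely_proper_action ::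
    "('a, 'm) monoid_scheme \<Rightarrow> 'a topology \<Rightarrow> 'x set \<Rightarrow> ('x \<times> 'x) set set \<Rightarrow>
      ('a \<Rightarrow> 'x \<Rightarrow> 'x) \<Rightarrow> bool"
  where "coarsely_proper_action G T X \<E> \<phi> \<longleftrightarrow>
    (\<forall>B. coarsely_bounded X \<E> B \<longrightarrow> group_coarsely_bounded G T (transporter G \<phi> B B))"

definition coarsely_dynamically_related ::
    "('a, 'm) monoid_scheme \<Rightarrow> 'a topology \<Rightarrow> ('a \<Rightarrow> 'x \<Rightarrow> 'x) \<Rightarrow> 'x set \<Rightarrow> 'x set \<Rightarrow> bool"
  where "coarsely_dynamically_related G T \<phi> A B \<longleftrightarrow>
    (\<exists>g :: nat \<Rightarrow> 'a. (\<forall>n. g n \<in> carrier G) \<and> tends_to_coarse_infinity G T g \<and>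
      (\<forall>n. \<phi> (g n) ` A \<inter> B \<noteq> {}))"

end

theory Submission
  imports Defs
begin

text \<open>
  The comparison of the first three conditions rests on one inclusion. Let \<open>B\<close> be coarsely bounded
  and \<open>x \<in> B\<close>. The whole set \<open>B\<close> is uniformly close to \<open>x\<close>, and since the group acts by uniform
  coarse equivalences, some single entourage \<open>M\<close> keeps every translate \<open>g B\<close> close to \<open>g x\<close>. So
  if \<open>g B\<close> meets \<open>B\<close>, then \<open>g x\<close> lies in \<open>M[B]\<close>: the transporter \<open>(B | B)\<close> is contained in the
  preimage of \<open>M[B]\<close> under the orbit map of \<open>x\<close> (\<open>transporter_subset_orbit_preimage\<close>). As \<open>M[B]\<close>
  is again coarsely bounded, properness of orbit maps gives properness of the action. Conversely, the
  preimage of \<open>B\<close> under an orbit map is contained in a transporter of \<open>B \<union> {x}\<close> to itself, and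
  \<open>B \<union> {x}\<close> is coarsely bounded by coarse connectedness. Thickenings of bounded sets are bounded,
  so the third condition is the first one applied to \<open>E[B]\<close>, and gives it back for diagonal \<open>E\<close>.

  For dynamical relations, the point is that coarse boundedness in the group is detected by
  sequences (\<open>group_coarsely_bounded_iff_no_sequence_to_infinity\<close>): failure of boundedness is
  witnessed by one continuous left-invariant pseudometric \<open>d\<close>, and a sequence that runs off to
  infinity for this one \<open>d\<close> leaves every coarsely bounded set. Hence an unbounded transporter
  \<open>(B | B)\<close> contains a sequence witnessing that \<open>B\<close> is dynamically related to itself.
\<close>

section \<open>Coarsely bounded sets\<close>

context coarse_space
begin

lemma coarsely_bounded_subset:
  assumes "coarsely_bounded X \<E> B" "A \<subseteq> B"
  shows "coarsely_bounded X \<E> A"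
  using assms subset_closed[of "B \<times> B" "A \<times> A"] unfolding coarsely_bounded_def by blast

text \<open>
  A single pair \<open>(a, b)\<close> with \<open>a \<in> A\<close> and \<open>b \<in> B\<close> bridges the two sets: \<open>A \<times> B\<close> is the
  composition of \<open>A \<times> A\<close>, \<open>{(a, b)}\<close> and \<open>B \<times> B\<close>. Without coarse connectedness the union of two
  nonempty bounded sets in different components is unbounded.
\<close>

lemma coarsely_bounded_Un:
  assumes conn: "coarsely_connected X \<E>"
    and A: "coarsely_bounded X \<E> A" and B: "coarsely_bounded X \<E> B"
  shows "coarsely_bounded X \<E> (A \<union> B)"
proof (cases "A = {} \<or> B = {}")
  case True
  then show ?thesis using A B by auto
next
  case False
  then obtain a b where ab: "a \<in> A" "b \<in> B" by blast
  have AA: "A \<times> A \<in> \<E>" "A \<subseteq> X" and BB: "B \<times> B \<in> \<E>" "B \<subseteq> X"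
    using A B by (auto simp: coarsely_bounded_def)
  have "{(a, b)} \<in> \<E>"
    using conn ab AA BB unfolding coarsely_connected_def by blast
  then have "(A \<times> A) O {(a, b)} O (B \<times> B) \<in> \<E>"
    using AA BB by (intro comp_closed)
  moreover have "(A \<times> A) O {(a, b)} O (B \<times> B) = A \<times> B" using ab by auto
  ultimately have AB: "A \<times> B \<in> \<E>" by simp
  have "B \<times> A \<in> \<E>" using inverse_closed[OF AB] by (simp add: converse_Times)
  with AA BB AB have "(A \<times> A \<union> B \<times> B) \<union> (A \<times> B \<union> B \<times> A) \<in> \<E>"
    by (intro Un_closed)
  moreover have "(A \<union> B) \<times> (A \<union> B) = (A \<times> A \<union> B \<times> B) \<union> (A \<times> B \<union> B \<times> A)" by auto
  ultimately show ?thesis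
    using AA BB by (simp add: coarsely_bounded_def)
qed

lemma coarsely_bounded_singleton:
  assumes "x \<in> X"
  shows "coarsely_bounded X \<E> {x}"
  using assms subset_closed[OF diagonal, of "{(x, x)}"] by (auto simp: coarsely_bounded_def)

text \<open>Two points of \<open>E[B]\<close> are linked by a step of \<open>E\<close> into \<open>B\<close>, a step inside \<open>B\<close>, and a step
  of \<open>E\<inverse>\<close> back out.\<close>

lemma coarsely_bounded_thickening:
  assumes B: "coarsely_bounded X \<E> B" and E: "E \<in> \<E>"
  shows "coarsely_bounded X \<E> (thickening X E B)"
proof -
  have "E O (B \<times> B) O E\<inverse> \<in> \<E>"
    using B E by (intro comp_closed inverse_closed) (auto simp: coarsely_bounded_def)
  moreover have "thickening X E B \<times> thickening X E B \<subseteq> E O (B \<times> B) O E\<inverse>"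
    by (fastforce simp: thickening_def)
  ultimately have "thickening X E B \<times> thickening X E B \<in> \<E>" by (rule subset_closed)
  then show ?thesis by (auto simp: coarsely_bounded_def thickening_def)
qed

lemma thickening_diagonal:
  assumes "B \<subseteq> X"
  shows "thickening X (Id_on X) B = B"
  using assms by (auto simp: thickening_def)

end

section \<open>Coarse boundedness in a topological group\<close>

lemma group_coarsely_bounded_subset:
  assumes "group_coarsely_bounded G T B" "A \<subseteq> B"
  shows "group_coarsely_bounded G T A"
proof -
  have "(\<lambda>(x, y). d x y) ` (A \<times> A) \<subseteq> (\<lambda>(x, y). d x y) ` (B \<times> B)" for d :: "'a \<Rightarrow> 'a \<Rightarrow> real"
    using assms(2) by blast
  then have "bdd_above ((\<lambda>(x, y). d x y) ` (A \<times> A))"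
    if "bdd_above ((\<lambda>(x, y). d x y) ` (B \<times> B))" for d :: "'a \<Rightarrow> 'a \<Rightarrow> real"
    using that bdd_above_mono by metis
  then show ?thesis
    using assms by (auto simp: coarsely_bounded_def left_coarse_structure_def)
qed

lemma not_tends_to_coarse_infinity:
  assumes "group_coarsely_bounded G T B" "\<And>n. g n \<in> B"
  shows "\<not> tends_to_coarse_infinity G T g"
  using assms unfolding tends_to_coarse_infinity_def by fastforce

text \<open>
  Escaping to infinity for a single pseudometric is enough: a coarsely bounded set has finite
  \<open>d\<close>-diameter, hence finite \<open>d\<close>-distance from \<open>a\<close>.
\<close>

lemma tends_to_coarse_infinityI:
  fixes d :: "'a \<Rightarrow> 'a \<Rightarrow> real" and g :: "nat \<Rightarrow> 'a"
  assumes d: "d \<in> left_invariant_pseudometrics G T"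
    and a: "a \<in> carrier G" and g: "\<And>n. g n \<in> carrier G"
    and far: "\<And>n. real n < d (g n) a"
  shows "tends_to_coarse_infinity G T g"
  unfolding tends_to_coarse_infinity_def
proof (intro allI impI)
  fix B assume B: "group_coarsely_bounded G T B"
  interpret pseudometric_space "carrier G" d
    using d by (simp add: left_invariant_pseudometrics_def)
  have "B \<subseteq> carrier G" "bdd_above ((\<lambda>(x, y). d x y) ` (B \<times> B))"
    using B d by (auto simp: coarsely_bounded_def left_coarse_structure_def)
  then obtain r where BG: "B \<subseteq> carrier G" and r: "\<And>x y. x \<in> B \<Longrightarrow> y \<in> B \<Longrightarrow> d x y \<le> r"
    by (fastforce simp: bdd_above_def)
  show "\<forall>\<^sub>F n in sequentially. g n \<notin> B"
  proof (cases "B = {}")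
    case False
    then obtain b where b: "b \<in> B" by blast
    obtain N :: nat where N: "r + d b a \<le> real N" using real_arch_simple by blast
    have "g n \<notin> B" if "N \<le> n" for n
    proof
      assume gB: "g n \<in> B"
      have "real n < d (g n) b + d b a"
        using far[of n] triangle[of "g n" b a] a b g BG by force
      also have "\<dots> \<le> r + d b a" using r gB b by simp
      also have "\<dots> \<le> real n" using N that by linarith
      finally show False by simp
    qed
    then show ?thesis by (auto simp: eventually_sequentially)
  qed simp
qed

text \<open>
  If \<open>A\<close> has infinite \<open>d\<close>-diameter and \<open>a \<in> A\<close>, then the \<open>d\<close>-distance from \<open>a\<close> is unbounded on
  \<open>A\<close>, because of two points at distance more than \<open>2 n\<close> at least one is at distance more than \<open>n\<close>
  from \<open>a\<close>. This yields a sequence in \<open>A\<close> escaping to infinity.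
\<close>

lemma group_coarsely_bounded_iff_no_sequence_to_infinity:
  assumes AG: "A \<subseteq> carrier G"
  shows "group_coarsely_bounded G T A \<longleftrightarrow>
    \<not> (\<exists>g. (\<forall>n. g n \<in> A) \<and> tends_to_coarse_infinity G T g)"
proof
  assume "group_coarsely_bounded G T A"
  then show "\<not> (\<exists>g. (\<forall>n. g n \<in> A) \<and> tends_to_coarse_infinity G T g)"
    using not_tends_to_coarse_infinity by blast
next
  assume none: "\<not> (\<exists>g. (\<forall>n. g n \<in> A) \<and> tends_to_coarse_infinity G T g)"
  show "group_coarsely_bounded G T A"
  proof (rule ccontr)
    assume "\<not> group_coarsely_bounded G T A"
    then obtain d where d: "d \<in> left_invariant_pseudometrics G T"
      and "\<not> bdd_above ((\<lambda>(x, y). d x y) ` (A \<times> A))"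
      using AG by (auto simp: coarsely_bounded_def left_coarse_structure_def)
    then have unb: "\<exists>x\<in>A. \<exists>y\<in>A. r < d x y" for r
      unfolding bdd_above_def by (fastforce simp: not_le)
    interpret pseudometric_space "carrier G" d
      using d by (simp add: left_invariant_pseudometrics_def)
    obtain a where a: "a \<in> A" using unb by blast
    have "\<exists>x\<in>A. real n < d x a" for n
    proof -
      obtain x y where xy: "x \<in> A" "y \<in> A" "2 * real n < d x y" using unb by blast
      have "d x y \<le> d x a + d y a"
        using triangle[of x a y] commute[of a y] xy a AG by auto
      then have "real n < d x a \<or> real n < d y a" using xy(3) by linarith
      then show ?thesis using xy by blast
    qed
    then obtain g where g: "\<And>n. g n \<in> A" "\<And>n. real n < d (g n) a" by metis
    then have "tends_to_coarse_infinity G T g"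
      using tends_to_coarse_infinityI[OF d] a AG by blast
    with none g show False by blast
  qed
qed

section \<open>Transporters and orbit maps\<close>

lemma orbit_preimage_subset_transporter:
  "{g \<in> carrier G. \<phi> g x \<in> B} \<subseteq> transporter G \<phi> (B \<union> {x}) (B \<union> {x})"
  unfolding transporter_def by blast

lemma transporter_mono:
  assumes "A \<subseteq> A'" "B \<subseteq> B'"
  shows "transporter G \<phi> A B \<subseteq> transporter G \<phi> A' B'"
  using assms unfolding transporter_def by blast

text \<open>The entourage \<open>M\<close> bounds all translates of \<open>B \<times> B\<close> simultaneously: if \<open>g b \<in> B\<close> with
  \<open>b \<in> B\<close>, then \<open>(g x, g b) \<in> M\<close> places \<open>g x\<close> in \<open>M[B]\<close>.\<close>

lemma transporter_subset_orbit_preimage: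
  assumes "group_action G X \<phi>" "x \<in> B" "B \<subseteq> X"
    and M: "(\<Union>g\<in>carrier G. (\<lambda>(x, y). (\<phi> g x, \<phi> g y)) ` (B \<times> B)) \<subseteq> M"
  shows "transporter G \<phi> B B \<subseteq> {g \<in> carrier G. \<phi> g x \<in> thickening X M B}"
proof
  fix g assume "g \<in> transporter G \<phi> B B"
  then obtain b where g: "g \<in> carrier G" and b: "b \<in> B" "\<phi> g b \<in> B"
    by (auto simp: transporter_def)
  have "(\<phi> g x, \<phi> g b) \<in> M" using M g b assms(2) by fastforce
  moreover have "\<phi> g x \<in> X"
    using group_action.element_image[OF assms(1) g] assms(2,3) by blast
  ultimately show "g \<in> {g \<in> carrier G. \<phi> g x \<in> thickening X M B}"
    using g b by (auto simp: thickening_def)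
qed

lemma coarsely_proper_action_iff_orbit_maps:
  assumes "coarse_space X \<E>" and conn: "coarsely_connected X \<E>" and act: "group_action G X \<phi>"
    and unif: "by_uniform_coarse_equivalences G \<E> \<phi>"
  shows "coarsely_proper_action G T X \<E> \<phi> \<longleftrightarrow>
    (\<forall>x\<in>X. coarsely_proper_map (carrier G) (left_coarse_structure G T) X \<E> (\<lambda>g. \<phi> g x))"
proof
  interpret coarse_space X \<E> by fact
  assume proper: "coarsely_proper_action G T X \<E> \<phi>"
  show "\<forall>x\<in>X. coarsely_proper_map (carrier G) (left_coarse_structure G T) X \<E> (\<lambda>g. \<phi> g x)"
    unfolding coarsely_proper_map_def
  proof (intro ballI conjI allI impI)
    fix x assume x: "x \<in> X"
    show "(\<lambda>g. \<phi> g x) \<in> carrier G \<rightarrow> X"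
      using group_action.element_image[OF act _ x] by blast
    fix B assume "coarsely_bounded X \<E> B"
    then have "coarsely_bounded X \<E> (B \<union> {x})"
      using coarsely_bounded_Un[OF conn] coarsely_bounded_singleton[OF x] by blast
    then have "group_coarsely_bounded G T (transporter G \<phi> (B \<union> {x}) (B \<union> {x}))"
      using proper unfolding coarsely_proper_action_def by blast
    then show "group_coarsely_bounded G T {g \<in> carrier G. \<phi> g x \<in> B}"
      by (rule group_coarsely_bounded_subset) (rule orbit_preimage_subset_transporter)
  qed
next
  interpret coarse_space X \<E> by fact
  assume orbits:
    "\<forall>x\<in>X. coarsely_proper_map (carrier G) (left_coarse_structure G T) X \<E> (\<lambda>g. \<phi> g x)"
  show "coarsely_proper_action G T X \<E> \<phi>"
    unfolding coarsely_proper_action_def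
  proof (intro allI impI)
    fix B assume B: "coarsely_bounded X \<E> B"
    then have BX: "B \<subseteq> X" and BB: "B \<times> B \<in> \<E>" by (auto simp: coarsely_bounded_def)
    show "group_coarsely_bounded G T (transporter G \<phi> B B)"
    proof (cases "B = {}")
      case True
      then show ?thesis
        by (simp add: transporter_def coarsely_bounded_def left_coarse_structure_def)
    next
      case False
      then obtain x where x: "x \<in> B" by blast
      obtain M where M: "M \<in> \<E>"
        "(\<Union>g\<in>carrier G. (\<lambda>(x, y). (\<phi> g x, \<phi> g y)) ` (B \<times> B)) \<subseteq> M"
        using unif BB unfolding by_uniform_coarse_equivalences_def by blast
      have "group_coarsely_bounded G T {g \<in> carrier G. \<phi> g x \<in> thickening X M B}"
        using orbits x BX coarsely_bounded_thickening[OF B M(1)]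
        unfolding coarsely_proper_map_def by blast
      then show ?thesis
        using transporter_subset_orbit_preimage[OF act x BX M(2)]
        by (rule group_coarsely_bounded_subset)
    qed
  qed
qed

lemma (in coarse_space) coarsely_proper_action_iff_thickened_transporters:
  "coarsely_proper_action G T X \<E> \<phi> \<longleftrightarrow>
    (\<forall>B. \<forall>E\<in>\<E>. coarsely_bounded X \<E> B \<longrightarrow>
      group_coarsely_bounded G T (transporter G \<phi> (thickening X E B) (thickening X E B)))"
proof
  assume "coarsely_proper_action G T X \<E> \<phi>"
  then show "\<forall>B. \<forall>E\<in>\<E>. coarsely_bounded X \<E> B \<longrightarrow>
      group_coarsely_bounded G T (transporter G \<phi> (thickening X E B) (thickening X E B))"
    unfolding coarsely_proper_action_def using coarsely_bounded_thickening by blast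
next
  assume thick: "\<forall>B. \<forall>E\<in>\<E>. coarsely_bounded X \<E> B \<longrightarrow>
      group_coarsely_bounded G T (transporter G \<phi> (thickening X E B) (thickening X E B))"
  show "coarsely_proper_action G T X \<E> \<phi>"
    unfolding coarsely_proper_action_def
  proof (intro allI impI)
    fix B assume B: "coarsely_bounded X \<E> B"
    then have "thickening X (Id_on X) B = B"
      by (simp add: thickening_diagonal coarsely_bounded_def)
    then show "group_coarsely_bounded G T (transporter G \<phi> B B)"
      using thick B diagonal by metis
  qed
qed

text \<open>
  Sequences in \<open>(A | B)\<close> are handled inside \<open>(A \<union> B | A \<union> B)\<close>, which reduces the two sets of a
  dynamical relation to the one set of coarse properness.
\<close>

lemma coarsely_proper_action_iff_not_dynamically_related:
  assumes "coarse_space X \<E>" and conn: "coarsely_connected X \<E>"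
  shows "coarsely_proper_action G T X \<E> \<phi> \<longleftrightarrow>
    \<not> (\<exists>A B. coarsely_bounded X \<E> A \<and> coarsely_bounded X \<E> B \<and>
          coarsely_dynamically_related G T \<phi> A B)"
proof -
  interpret coarse_space X \<E> by fact
  have related_iff: "coarsely_dynamically_related G T \<phi> A B \<longleftrightarrow>
      \<not> group_coarsely_bounded G T (transporter G \<phi> A B)" for A B
  proof -
    have "transporter G \<phi> A B \<subseteq> carrier G" by (auto simp: transporter_def)
    note group_coarsely_bounded_iff_no_sequence_to_infinity[OF this, of T]
    then show ?thesis
      unfolding coarsely_dynamically_related_def transporter_def by blast
  qed
  have "group_coarsely_bounded G T (transporter G \<phi> A B)"
    if "coarsely_proper_action G T X \<E> \<phi>" "coarsely_bounded X \<E> A" "coarsely_bounded X \<E> B"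
    for A B
  proof -
    have "group_coarsely_bounded G T (transporter G \<phi> (A \<union> B) (A \<union> B))"
      using that coarsely_bounded_Un[OF conn] unfolding coarsely_proper_action_def by blast
    then show ?thesis
      by (rule group_coarsely_bounded_subset) (intro transporter_mono Un_upper1 Un_upper2)
  qed
  then show ?thesis
    unfolding related_iff coarsely_proper_action_def by blast
qed

section \<open>Characterisations of coarsely proper actions\<close>

theorem theorem4p2:
  fixes G :: "('a, 'm) monoid_scheme"
    and T :: "'a topology"
    and X :: "'x set"
    and \<E> :: "('x \<times> 'x) set set"
    and S :: "'x topology"
    and \<phi> :: "'a \<Rightarrow> 'x \<Rightarrow> 'x"
  assumes "topological_group G T"
    and "coarse_space X \<E>"
    and "coarsely_connected X \<E>"
    and "topspace S = X"
    and "group_action G X \<phi>"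
    and "continuous_action T S \<phi>"
    and "by_uniform_coarse_equivalences G \<E> \<phi>"
    and "polish_topology T \<or>
      (\<exists>d. pseudometric_space X d \<and> \<E> = pseudometric_coarse_structure X d \<and>
           S = pseudometric_topology X d)"
  shows
    "(coarsely_proper_action G T X \<E> \<phi> \<longleftrightarrow>
       (\<forall>x\<in>X. coarsely_proper_map (carrier G) (left_coarse_structure G T) X \<E> (\<lambda>g. \<phi> g x)))
     \<and>
     ((\<forall>x\<in>X. coarsely_proper_map (carrier G) (left_coarse_structure G T) X \<E> (\<lambda>g. \<phi> g x)) \<longleftrightarrow>
       (\<forall>B. \<forall>E\<in>\<E>. coarsely_bounded X \<E> B \<longrightarrow>
          group_coarsely_bounded G T (transporter G \<phi> (thickening X E B) (thickening X E B))))
     \<and>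
     (locally_bounded_group G T \<longrightarrow>
       (coarsely_proper_action G T X \<E> \<phi> \<longleftrightarrow>
         \<not> (\<exists>A B. coarsely_bounded X \<E> A \<and> coarsely_bounded X \<E> B \<and>
                coarsely_dynamically_related G T \<phi> A B)))"
  using coarsely_proper_action_iff_orbit_maps[OF assms(2,3,5,7), of T]
    coarse_space.coarsely_proper_action_iff_thickened_transporters[OF assms(2), of G T \<phi>]
    coarsely_proper_action_iff_not_dynamically_related[OF assms(2,3), of G T \<phi>]
  by argo

end
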